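(* Latent force models are not controllable: for every latent force model $\dot{\mathbf{g}}=\mathbf{A}\mathbf{g}+\mathbf{B}\mathbf{w}+\mathbf{M}\mathbf{c}$ of the form given in the context, the pair $(\mathbf{A},\mathbf{M})$ (with respect to the control input $\mathbf{c}$) is not controllable.
   Context: A (finite-dimensional, controlled) latent force model is $\dot{\mathbf{g}}(t)=\mathbf{A}\mathbf{g}(t)+\mathbf{B}\mathbf{w}(t)+\mathbf{M}\mathbf{c}(t)$ with $\mathbf{g}=(\mathbf{f},\mathbf{u})\in\mathbb{R}^{n_f}\times\mathbb{R}^{n_u}$, $n_u\ge 1$, $$\mathbf{A}=\begin{pmatrix}\mathbf{A}_f&\mathbf{B}_f\mathbf{C}_u\\ \mathbf{0}&\mathbf{A}_u\end{pmatrix},\quad \mathbf{B}=\begin{pmatrix}\mathbf{0}\\ \mathbf{B}_u\end{pmatrix},\quad \mathbf{M}=\begin{pmatrix}\mathbf{M}_f\\ \mathbf{0}\end{pmatrix},$$ where all blocks are constant real matrices of compatible dimensions, $\mathbf{f}$ is the state of the physical system, $\mathbf{u}$ the state of the latent force (a state-space representation of the Gaussian process input), $\mathbf{w}$ white noise and $\mathbf{c}$ the control. Controllability is meant in the usual sense of the linear system $\dot{\mathbf{g}}=\mathbf{A}\mathbf{g}+\mathbf{M}\mathbf{c}$: any initial state can be steered to any final state in finite time by some control. *)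

theory Defs
  imports "HOL-Analysis.Equivalence_Lebesgue_Henstock_Integration" "Jordan_Normal_Form.Matrix"
begin

no_notation Finite_Cartesian_Product.vec_nth (infixl "$" 90)

text \<open>Matrices carry their dimensions explicitly, so that all dimensions are arbitrary natural
  numbers and \<open>nf\<close>, \<open>nw\<close>, \<open>nc\<close> (physical state, noise, control) may be \<open>0\<close>. The
  dimension \<open>nl\<close> of the latent output \<open>Cu u\<close> driving the physical system is unconstrained.\<close>

definition latent_force_model ::
  "nat \<Rightarrow> nat \<Rightarrow> nat \<Rightarrow> nat \<Rightarrow> real mat \<Rightarrow> real mat \<Rightarrow> real mat \<Rightarrow> bool" where
  "latent_force_model nf nu nw nc A B M \<longleftrightarrow> nu \<ge> 1 \<and>
     (\<exists>nl Af Bf Cu Au Bu Mf.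
        Af \<in> carrier_mat nf nf \<and> Bf \<in> carrier_mat nf nl \<and> Cu \<in> carrier_mat nl nu \<and>
        Au \<in> carrier_mat nu nu \<and> Bu \<in> carrier_mat nu nw \<and> Mf \<in> carrier_mat nf nc \<and>
        A = four_block_mat Af (Bf * Cu) (0\<^sub>m nu nf) Au \<and>
        B = append_rows (0\<^sub>m nf nw) Bu \<and>
        M = append_rows Mf (0\<^sub>m nu nc))"

text \<open>Controls are Lebesgue integrable on \<open>[0, T]\<close>, which includes the piecewise continuous and
  the square-integrable ones.\<close>

definition admissible_control :: "nat \<Rightarrow> real \<Rightarrow> (real \<Rightarrow> real Matrix.vec) \<Rightarrow> bool" where
  "admissible_control m T c \<longleftrightarrow>
     (\<forall>t\<in>{0..T}. c t \<in> carrier_vec m) \<and>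
     (\<forall>j<m. (\<lambda>t. c t $ j) absolutely_integrable_on {0..T})"

text \<open>Solutions of \<open>g' = A g + M c\<close> are meant in the sense of Caratheodory, i.e. in integrated
  form, since a discontinuous control does not yield a trajectory differentiable everywhere.\<close>

definition is_trajectory ::
  "nat \<Rightarrow> real mat \<Rightarrow> real mat \<Rightarrow> real \<Rightarrow> (real \<Rightarrow> real Matrix.vec) \<Rightarrow> (real \<Rightarrow> real Matrix.vec) \<Rightarrow> bool"
where
  "is_trajectory n A M T c g \<longleftrightarrow>
     (\<forall>t\<in>{0..T}. g t \<in> carrier_vec n) \<and>
     (\<forall>i<n. \<forall>t\<in>{0..T}.
        ((\<lambda>s. (A *\<^sub>v g s + M *\<^sub>v c s) $ i) has_integral (g t $ i - g 0 $ i)) {0..t})"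

definition controllable :: "nat \<Rightarrow> nat \<Rightarrow> real mat \<Rightarrow> real mat \<Rightarrow> bool" where
  "controllable n m A M \<longleftrightarrow>
     (\<forall>x0 \<in> carrier_vec n. \<forall>x1 \<in> carrier_vec n.
        \<exists>T>0. \<exists>c g. admissible_control m T c \<and> is_trajectory n A M T c g \<and>
          g 0 = x0 \<and> g T = x1)"

end

(* The control does not enter the latent block: along every trajectory u' = Au u. By uniqueness,
   a trajectory starting at 0 keeps u = 0, so no state with u \<noteq> 0 can be reached from the origin. *)
theory Submission
  imports Defs
begin

text \<open>By 2|x y| \<le> x^2 + y^2, and since each single square is at most the whole sum of
  squares, every product \<open>x i * x j\<close> is bounded by that sum. The crude constant
  suffices: the bound serves as the differential inequality E' \<le> K E for E = |u|^2 along u' = a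
  u.\<close>

lemma quadratic_form_bound:
  fixes x :: "'i \<Rightarrow> real"
  assumes "finite I"
  shows "(\<Sum>i\<in>I. 2 * x i * (\<Sum>j\<in>I. a i j * x j)) \<le>
    2 * (\<Sum>i\<in>I. \<Sum>j\<in>I. \<bar>a i j\<bar>) * (\<Sum>i\<in>I. (x i)\<^sup>2)" (is "_ \<le> 2 * ?K * ?E")
proof -
  have le: "2 * x i * (a i j * x j) \<le> 2 * \<bar>a i j\<bar> * ?E" if "i \<in> I" "j \<in> I" for i j
  proof -
    have sq: "(x k)\<^sup>2 \<le> ?E" if "k \<in> I" for k
      using assms that by (intro member_le_sum) auto
    have "2 * \<bar>x i\<bar> * \<bar>x j\<bar> \<le> \<bar>x i\<bar>\<^sup>2 + \<bar>x j\<bar>\<^sup>2"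
      by (rule sum_squares_bound)
    then have "\<bar>x i\<bar> * \<bar>x j\<bar> \<le> ?E"
      using sq[OF that(1)] sq[OF that(2)] by simp
    then have "\<bar>a i j\<bar> * (\<bar>x i\<bar> * \<bar>x j\<bar>) \<le> \<bar>a i j\<bar> * ?E"
      by (rule mult_left_mono) simp
    moreover have "x i * (a i j * x j) \<le> \<bar>x i * (a i j * x j)\<bar>"
      by (rule abs_ge_self)
    ultimately show ?thesis
      by (simp add: abs_mult mult_ac)
  qed
  have "(\<Sum>i\<in>I. 2 * x i * (\<Sum>j\<in>I. a i j * x j)) = (\<Sum>i\<in>I. \<Sum>j\<in>I. 2 * x i * (a i j * x j))"
    by (simp add: sum_distrib_left)
  also have "\<dots> \<le> (\<Sum>i\<in>I. \<Sum>j\<in>I. 2 * \<bar>a i j\<bar> * ?E)"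
    by (intro sum_mono le)
  also have "\<dots> = 2 * ?K * ?E"
    by (simp only: sum_distrib_left[of 2] sum_distrib_right[of _ _ ?E])
  finally show ?thesis .
qed

text \<open>Uniqueness for u' = a u with u(0) = 0, by a Gronwall argument on the squared norm E.
  Only the integral equation is given, so regularity is bootstrapped first: an indefinite integral
  is continuous, hence so is the integrand \<open>F\<close>, hence u is differentiable.\<close>

lemma linear_integral_equation_zero:
  fixes u :: "'i \<Rightarrow> real \<Rightarrow> real"
  assumes fin: "finite I"
    and sol: "\<And>i t. i \<in> I \<Longrightarrow> t \<in> {0..T} \<Longrightarrow>
      ((\<lambda>s. \<Sum>j\<in>I. a i j * u j s) has_integral u i t) {0..t}"
    and "i \<in> I" "t \<in> {0..T}"
  shows "u i t = 0"
proof -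
  define F where "F i s = (\<Sum>j\<in>I. a i j * u j s)" for i s
  have int: "(F i has_integral u i t) {0..t}" if "i \<in> I" "t \<in> {0..T}" for i t
    using sol[OF that] by (simp add: F_def[abs_def])
  have u_eq: "u i t = integral {0..t} (F i)" if "i \<in> I" "t \<in> {0..T}" for i t
    using int[OF that] by (simp add: integral_unique)
  have T: "T \<in> {0..T}" using assms(4) by auto
  have cont_u: "continuous_on {0..T} (u i)" if "i \<in> I" for i
  proof -
    have "continuous_on {0..T} (\<lambda>t. integral {0..t} (F i))"
      using int[OF that T] by (intro indefinite_integral_continuous_1) (auto simp: integrable_on_def)
    then show ?thesis
      by (rule continuous_on_eq) (simp add: u_eq that)
  qed
  then have cont_F: "continuous_on {0..T} (F i)" for i
    unfolding F_def by (intro continuous_intros) auto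
  \<comment> \<open>The fundamental theorem gives a derivative within \<open>{0..T}\<close>; at
    interior points it is two-sided.\<close>
  have deriv_u: "(u i has_real_derivative F i t) (at t)" if "i \<in> I" "0 < t" "t < T" for i t
  proof -
    have "((\<lambda>t. integral {0..t} (F i)) has_real_derivative F i t) (at t within {0..T})"
      using that by (intro integral_has_real_derivative cont_F) auto
    then have "(u i has_real_derivative F i t) (at t within {0..T})"
      using that by (elim has_field_derivative_transform_within[where d = 1]) (auto simp: u_eq)
    then show ?thesis
      using that by (simp add: at_within_Icc_at)
  qed
  define K where "K = 2 * (\<Sum>i\<in>I. \<Sum>j\<in>I. \<bar>a i j\<bar>)"
  define E where "E t = (\<Sum>i\<in>I. (u i t)\<^sup>2)" for t
  define G where "G t = exp (- K * t) * E t" for t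
  \<comment> \<open>With the integrating factor, G' = exp(-K s) (E' - K E) \<le> 0. Derivatives are
    known only in the open interval, so continuity covers the endpoints.\<close>
  have "G t \<le> G 0"
  proof (rule DERIV_nonpos_imp_decreasing_open[where f = G])
    show "0 \<le> t" using assms(4) by simp
    show "continuous_on {0..t} G"
      unfolding G_def E_def using assms(4)
      by (intro continuous_intros continuous_on_subset[OF cont_u]) auto
    fix s assume s: "0 < s" "s < t"
    define D where "D = (\<Sum>i\<in>I. 2 * u i s * F i s)"
    have "(E has_real_derivative D) (at s)"
      unfolding E_def D_def using s assms(4)
      by (intro DERIV_sum) (auto intro!: derivative_eq_intros deriv_u)
    then have "(G has_real_derivative exp (- K * s) * (D - K * E s)) (at s)"
      unfolding G_def by (auto intro!: derivative_eq_intros simp: algebra_simps)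
    moreover have "D \<le> K * E s"
      unfolding D_def F_def K_def E_def by (rule quadratic_form_bound[OF fin])
    ultimately show "\<exists>y. DERIV G s :> y \<and> y \<le> 0"
      by (intro exI conjI) (auto intro!: mult_nonneg_nonpos)
  qed
  \<comment> \<open>At time 0 the integral runs over the degenerate interval \<open>{0..0}\<close>,
    so every \<open>u i 0\<close> vanishes.\<close>
  also have "G 0 = 0"
    using u_eq[of _ 0] T by (simp add: G_def E_def)
  finally have "E t \<le> 0"
    by (simp add: G_def mult_le_0_iff)
  then have "E t = 0"
    by (simp add: E_def sum_nonneg antisym)
  then show ?thesis
    using fin assms(3) by (simp add: E_def sum_nonneg_eq_0_iff)
qed

text \<open>The zero lower-left block of \<open>A\<close> removes the physical state from the latent
  rows, and the zero lower block of \<open>M\<close> removes the control.\<close>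

lemma latent_component:
  fixes A M :: "real mat" and x c :: "real Matrix.vec"
  assumes A: "A = four_block_mat Af Bl (0\<^sub>m nu nf) Au" and M: "M = append_rows Mf (0\<^sub>m nu nc)"
    and carr: "Af \<in> carrier_mat nf nf" "Au \<in> carrier_mat nu nu" "Mf \<in> carrier_mat nf nc"
    and x: "x \<in> carrier_vec (nf + nu)" and c: "c \<in> carrier_vec nc" and i: "i < nu"
  shows "(A *\<^sub>v x + M *\<^sub>v c) $ (nf + i) = (\<Sum>j<nu. Au $$ (i, j) * x $ (nf + j))"
proof -
  have "(A *\<^sub>v x) $ (nf + i) = (\<Sum>j\<in>{0..<nf + nu}. A $$ (nf + i, j) * x $ j)"
    using carr x i by (simp add: A scalar_prod_def)
  \<comment> \<open>Columns below \<open>nf\<close> meet row \<open>nf + i\<close> in the zero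
    block.\<close>
  also have "\<dots> = (\<Sum>j\<in>{nf..<nf + nu}. A $$ (nf + i, j) * x $ j)"
    using carr i by (intro sum.mono_neutral_right) (auto simp: A)
  also have "\<dots> = (\<Sum>j<nu. A $$ (nf + i, nf + j) * x $ (nf + j))"
    by (rule sum.reindex_bij_witness[of _ "\<lambda>j. nf + j" "\<lambda>j. j - nf"]) auto
  also have "\<dots> = (\<Sum>j<nu. Au $$ (i, j) * x $ (nf + j))"
    using carr i by (intro sum.cong) (auto simp: A)
  finally have "(A *\<^sub>v x) $ (nf + i) = \<dots>" .
  moreover have "(M *\<^sub>v c) $ (nf + i) = 0"
    using carr c i by (simp add: M append_rows_def scalar_prod_def)
  moreover have "dim_row M = nf + nu"
    using carr by (simp add: M append_rows_def)
  ultimately show ?thesis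
    using i by simp
qed

theorem mainTheorem5:
  fixes nf nu nw nc :: nat and A B M :: "real mat"
  assumes "latent_force_model nf nu nw nc A B M"
  shows "\<not> controllable (nf + nu) nc A M"
proof
  assume ctrl: "controllable (nf + nu) nc A M"
  from assms obtain nl Af Bf Cu Au Mf where nu: "nu \<ge> 1"
    and carr: "Af \<in> carrier_mat nf nf" "Au \<in> carrier_mat nu nu" "Mf \<in> carrier_mat nf nc"
    and A: "A = four_block_mat Af (Bf * Cu) (0\<^sub>m nu nf) Au"
    and M: "M = append_rows Mf (0\<^sub>m nu nc)"
    unfolding latent_force_model_def by blast
  \<comment> \<open>Indices start at 0, so \<open>nf\<close> is the first latent coordinate; it
    exists because \<open>nu\<close> is at least 1. The unit vector there is the unreachable
    target.\<close>
  have "0\<^sub>v (nf + nu) \<in> carrier_vec (nf + nu)" "unit_vec (nf + nu) nf \<in> carrier_vec (nf + nu)"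
    by simp_all
  with ctrl obtain T c g where T: "T > 0" and adm: "admissible_control nc T c"
    and traj: "is_trajectory (nf + nu) A M T c g"
    and g0: "g 0 = 0\<^sub>v (nf + nu)" and gT: "g T = unit_vec (nf + nu) nf"
    unfolding controllable_def by metis
  \<comment> \<open>The index is written \<open>nf + 0\<close> to match \<open>u i t\<close> at
    \<open>i = 0\<close>.\<close>
  have "g T $ (nf + 0) = 0"
  proof (rule linear_integral_equation_zero[where I = "{..<nu}" and u = "\<lambda>i t. g t $ (nf + i)"
        and a = "\<lambda>i j. Au $$ (i, j)" and T = T])
    fix i t assume i: "i \<in> {..<nu}" and t: "t \<in> {0..T}"
    \<comment> \<open>Starting at the origin removes the term \<open>g 0 $ (nf + i)\<close> from the
      trajectory equation, leaving the homogeneous form that the uniqueness lemma requires.\<close>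
    have "((\<lambda>s. (A *\<^sub>v g s + M *\<^sub>v c s) $ (nf + i)) has_integral g t $ (nf + i)) {0..t}"
      using traj i t g0 unfolding is_trajectory_def by force
    moreover have "(A *\<^sub>v g s + M *\<^sub>v c s) $ (nf + i) = (\<Sum>j<nu. Au $$ (i, j) * g s $ (nf + j))"
      if "s \<in> {0..t}" for s
      using adm traj i t that
      by (intro latent_component[OF A M carr]) (auto simp: admissible_control_def is_trajectory_def)
    ultimately show "((\<lambda>s. \<Sum>j<nu. Au $$ (i, j) * g s $ (nf + j)) has_integral g t $ (nf + i)) {0..t}"
      by (rule has_integral_eq[rotated])
  qed (use T nu in auto)
  then show False
    using gT nu by simp
qed

end
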